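(* Let $(X,p)$ be a partial metric space and let $a$ be a positive real number such that $p(x,x)=a$ for all $x\in X$. Let $r\ge 0$ and let $\{x_n\}$ be an $r$-convergent sequence in $X$. Then the diameter of its $r$-limit set is not greater than $2r+2a$, i.e. $\operatorname{Diam}(LIM^{r}x_n)\le 2r+2a$.
   Context: A partial metric on a nonempty set $X$ is a function $p:X\times X\to[0,\infty)$ such that for all $x,y,z\in X$: (p1) $0\le p(x,x)\le p(x,y)$; (p2) $x=y \iff p(x,x)=p(x,y)=p(y,y)$; (p3) $p(x,y)=p(y,x)$; (p4) $p(x,y)\le p(x,z)+p(z,y)-p(z,z)$. The pair $(X,p)$ is a partial metric space. For a real number $r\ge 0$, a sequence $\{x_n\}$ in $X$ is $r$-convergent to $x\in X$ (rough convergent of roughness degree $r$) if for every $\epsilon>0$ there is $k\in\mathbb{N}$ such that $|p(x_n,x)-p(x,x)|<r+\epsilon$ for all $n\ge k$. It is $r$-convergent if it is $r$-convergent to some $x\in X$. The $r$-limit set is $LIM^{r}x_n=\{x\in X:\{x_n\}\text{ is }r\text{-convergent to }x\}$. For $A\subseteq X$, $\operatorname{Diam}(A)=\sup\{p(x,y):x,y\in A\}$. *)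

theory Defs
  imports Complex_Main "HOL-Library.Extended_Real"
begin

locale partial_metric_space =
  fixes X :: "'a set" and p :: "'a \<Rightarrow> 'a \<Rightarrow> real"
  assumes nonempty: "X \<noteq> {}"
    and self_nonneg: "x \<in> X \<Longrightarrow> 0 \<le> p x x"
    and self_le: "x \<in> X \<Longrightarrow> y \<in> X \<Longrightarrow> p x x \<le> p x y"
    and eq_iff: "x \<in> X \<Longrightarrow> y \<in> X \<Longrightarrow> x = y \<longleftrightarrow> p x x = p x y \<and> p x y = p y y"
    and sym: "x \<in> X \<Longrightarrow> y \<in> X \<Longrightarrow> p x y = p y x"
    and triangle: "x \<in> X \<Longrightarrow> y \<in> X \<Longrightarrow> z \<in> X \<Longrightarrow> p x y \<le> p x z + p z y - p z z"

text \<open>The following notions take the partial metric as an explicit argument; membership of the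
  terms of the sequence in the carrier is left to the user of these definitions.\<close>

definition rough_converges_to ::
    "('a \<Rightarrow> 'a \<Rightarrow> real) \<Rightarrow> real \<Rightarrow> (nat \<Rightarrow> 'a) \<Rightarrow> 'a \<Rightarrow> bool" where
  "rough_converges_to p r s x \<longleftrightarrow>
     (\<forall>\<epsilon>>0. \<exists>k. \<forall>n\<ge>k. \<bar>p (s n) x - p x x\<bar> < r + \<epsilon>)"

definition rough_limit_set ::
    "'a set \<Rightarrow> ('a \<Rightarrow> 'a \<Rightarrow> real) \<Rightarrow> real \<Rightarrow> (nat \<Rightarrow> 'a) \<Rightarrow> 'a set" where
  "rough_limit_set X p r s = {x \<in> X. rough_converges_to p r s x}"

definition rough_convergent ::
    "'a set \<Rightarrow> ('a \<Rightarrow> 'a \<Rightarrow> real) \<Rightarrow> real \<Rightarrow> (nat \<Rightarrow> 'a) \<Rightarrow> bool" where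
  "rough_convergent X p r s \<longleftrightarrow> (\<exists>x\<in>X. rough_converges_to p r s x)"

text \<open>The supremum is taken in the extended reals, so that an unbounded set has diameter
  \<open>\<infinity>\<close>; a real-valued supremum would be unspecified there.\<close>

definition Diam :: "('a \<Rightarrow> 'a \<Rightarrow> real) \<Rightarrow> 'a set \<Rightarrow> ereal" where
  "Diam p A = Sup {ereal (p x y) | x y. x \<in> A \<and> y \<in> A}"

end

theory Submission imports Defs begin

text \<open>Two rough limits \<open>x\<close> and \<open>y\<close> are compared through one late
  term \<open>s n\<close>. Its distance to each exceeds that limit's self-distance by less than
  \<open>r + e / 2\<close>, so the triangle inequality bounds \<open>p x y\<close> by
  \<open>2 * r + p x x + p y y + e\<close>, with \<open>e\<close> arbitrary
  (\<open>rough_limits_dist_le\<close>). Self-distances equal to \<open>a\<close> turn this into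
  \<open>2 * r + 2 * a\<close>, uniformly over the limit set.\<close>

lemma (in partial_metric_space) rough_limits_dist_le:
  assumes s: "\<And>n. s n \<in> X" and xX: "x \<in> X" and yX: "y \<in> X"
    and x: "rough_converges_to p r s x" and y: "rough_converges_to p r s y"
  shows "p x y \<le> 2 * r + p x x + p y y"
proof (rule field_le_epsilon)
  fix e :: real assume "e > 0"
  then have "e / 2 > 0" by simp
  then obtain k l where
    k: "\<And>n. n \<ge> k \<Longrightarrow> \<bar>p (s n) x - p x x\<bar> < r + e / 2" and
    l: "\<And>n. n \<ge> l \<Longrightarrow> \<bar>p (s n) y - p y y\<bar> < r + e / 2"
    using x y unfolding rough_converges_to_def by meson
  define n where "n = max k l"
  have "\<bar>p (s n) x - p x x\<bar> < r + e / 2" "\<bar>p (s n) y - p y y\<bar> < r + e / 2"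
    using k l by (simp_all add: n_def)
  moreover have "p x y \<le> p x (s n) + p (s n) y - p (s n) (s n)"
    using triangle xX yX s by blast
  moreover have "p x (s n) = p (s n) x" using sym xX s by blast
  \<comment> \<open>The triangle inequality subtracts this self-distance, so its nonnegativity
    allows it to be dropped.\<close>
  moreover have "0 \<le> p (s n) (s n)" using self_nonneg s by blast
  ultimately show "p x y \<le> 2 * r + p x x + p y y + e" by linarith
qed

theorem theorem3p1:
  fixes X :: "'a set" and p :: "'a \<Rightarrow> 'a \<Rightarrow> real" and a r :: real and s :: "nat \<Rightarrow> 'a"
  assumes "partial_metric_space X p"
    and "a > 0"
    and "\<And>x. x \<in> X \<Longrightarrow> p x x = a"
    and "r \<ge> 0"
    and "\<And>n. s n \<in> X"
    and "rough_convergent X p r s"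
  shows "Diam p (rough_limit_set X p r s) \<le> ereal (2 * r + 2 * a)"
proof -
  have "p x y \<le> 2 * r + 2 * a"
    if "x \<in> rough_limit_set X p r s" "y \<in> rough_limit_set X p r s" for x y
    using partial_metric_space.rough_limits_dist_le[where s = s, OF assms(1,5), of x y r] assms(3)[of x]
      assms(3)[of y] that
    by (simp add: rough_limit_set_def)
  \<comment> \<open>In the complete lattice \<open>ereal\<close> a pointwise bound suffices;
    boundedness and nonemptiness need no separate check.\<close>
  then show ?thesis unfolding Diam_def by (intro Sup_least) auto
qed

end
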